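(* Let $(\tau_n)_{n\ge 0}$ be the random recursive tree with doubling events at the root, and let $B_n = |\tau_n|-1$ be the number of non-root nodes of $\tau_n$. Then: (a) For all integers $k\geq 1$, as $n\to\infty$, $$\mathbb E\big[(B_n/n)^k\big] \to m_k := \prod_{i=1}^k \Big(1-\frac1i+\frac{2^i}{i}\Big) = \frac{2^{k(k+1)/2}}{k!}\prod_{i=1}^k \Big(1+\frac{i-1}{2^i}\Big).$$ (b) The sequence of random variables $(B_n/n)_{n\geq 1}$ is tight. (c) For any sequence of real numbers $(\omega(n))_{n\geq 0}$ such that $n= o(\omega(n))$ as $n\to\infty$, $B_n/\omega(n) \to 0$ in probability as $n\to\infty$. (d) For any $\eta>0$, $B_n/n^{1+\eta}\to 0$ almost surely as $n\to\infty$.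
   Context: Trees (Ulam--Harris notation): a tree is a set $\tau$ of finite words over the alphabet $\{1,2,3,\ldots\}$ such that every prefix of a word of $\tau$ (including the empty word $\varnothing$, called the root) is in $\tau$. Elements of $\tau$ are called nodes; $|\tau|$ is the number of nodes. The random recursive tree with doubling events $(\tau_n)_{n\ge0}$ is defined by $\tau_0=\{\varnothing\}$ and, for all $n\ge0$, given $\tau_n$ (and the past): pick a node $\nu_n$ uniformly at random among the nodes of $\tau_n$; - if $\nu_n=\varnothing$, set $\tau_{n+1}=\{\varnothing\}\cup\{1w: w\in\tau_n\}\cup\{2w: w\in\tau_n\}$ (a doubling event); - if $\nu_n\ne\varnothing$, set $\tau_{n+1}=\tau_n\cup\{\nu_n j\}$ where $j=\min\{i\ge1:\nu_n i\notin\tau_n\}$. *)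

theory Defs
  imports "HOL-Probability.Probability" "HOL-Library.Landau_Symbols" "HOL-Library.Sublist"
begin

text \<open>Words over \<open>{1, 2, 3, \<dots>}\<close> are lists of positive natural numbers; the root is \<^term>\<open>[]\<close>.\<close>

definition is_tree :: "nat list set \<Rightarrow> bool" where
  "is_tree t \<longleftrightarrow> [] \<in> t \<and> (\<forall>w\<in>t. 0 \<notin> set w) \<and> (\<forall>w\<in>t. \<forall>u. prefix u w \<longrightarrow> u \<in> t)"

definition double_tree :: "nat list set \<Rightarrow> nat list set" where
  "double_tree t = {[]} \<union> {1 # w |w. w \<in> t} \<union> {2 # w |w. w \<in> t}"

definition add_child :: "nat list set \<Rightarrow> nat list \<Rightarrow> nat list set" where
  "add_child t v = t \<union> {v @ [LEAST i. 1 \<le> i \<and> v @ [i] \<notin> t]}"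

definition tree_step :: "nat list set \<Rightarrow> nat list \<Rightarrow> nat list set" where
  "tree_step t v = (if v = [] then double_tree t else add_child t v)"

text \<open>The process lives on an arbitrary probability space. The law of the chosen node \<open>\<nu> n\<close> is
  prescribed conditionally on every attainable history, with elementary conditional probabilities:
  no generality is lost, because only countably many histories are possible.\<close>

locale doubling_tree_process = prob_space M for M :: "'w measure" +
  fixes \<nu> :: "nat \<Rightarrow> 'w \<Rightarrow> nat list"
    and \<tau> :: "nat \<Rightarrow> 'w \<Rightarrow> nat list set"
  assumes random_node: "random_variable (count_space UNIV) (\<nu> n)"
    and tree_0: "\<omega> \<in> space M \<Longrightarrow> \<tau> 0 \<omega> = {[]}"
    and tree_Suc: "\<omega> \<in> space M \<Longrightarrow> \<tau> (Suc n) \<omega> = tree_step (\<tau> n \<omega>) (\<nu> n \<omega>)"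
    and uniform_node:
      "\<P>(\<omega> in M. (\<forall>i\<le>n. \<tau> i \<omega> = t i) \<and> (\<forall>i<n. \<nu> i \<omega> = u i)) > 0 \<Longrightarrow>
       \<P>(\<omega> in M. \<nu> n \<omega> = v \<bar> (\<forall>i\<le>n. \<tau> i \<omega> = t i) \<and> (\<forall>i<n. \<nu> i \<omega> = u i))
         = pmf (pmf_of_set (t n)) v"

definition nonroot_count :: "nat list set \<Rightarrow> real" where
  "nonroot_count t = real (card t) - 1"

definition moment_limit :: "nat \<Rightarrow> real" where
  "moment_limit k = (\<Prod>i=1..k. 1 - 1 / real i + 2 ^ i / real i)"

definition tendsto_in_prob :: "'w measure \<Rightarrow> (nat \<Rightarrow> 'w \<Rightarrow> real) \<Rightarrow> real \<Rightarrow> bool" where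
  "tendsto_in_prob M X c \<longleftrightarrow> (\<forall>\<epsilon>>0. (\<lambda>n. \<P>(\<omega> in M. \<bar>X n \<omega> - c\<bar> > \<epsilon>)) \<longlonglongrightarrow> 0)"

text \<open>Finite trees are preserved by the dynamics, so the minimum in \<^const>\<open>add_child\<close> exists and
  \<^const>\<open>pmf_of_set\<close> and \<^const>\<open>card\<close> are only ever applied to finite nonempty sets.\<close>

lemma tree_step_preserves:
  assumes fin: "finite t" and t: "is_tree t" and v: "v \<in> t"
  shows "finite (tree_step t v)" and "is_tree (tree_step t v)"
proof -
  have "{1 # w |w. w \<in> t} = (#) 1 ` t" "{2 # w |w. w \<in> t} = (#) 2 ` t"
    by auto
  then show "finite (tree_step t v)"
    using fin by (simp add: tree_step_def double_tree_def add_child_def)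
  show "is_tree (tree_step t v)"
  proof (cases "v = []")
    case True
    then show ?thesis
      using t by (auto simp: tree_step_def double_tree_def is_tree_def prefix_Cons)
  next
    case False
    let ?P = "\<lambda>i. 1 \<le> i \<and> v @ [i] \<notin> t"
    have "inj_on (\<lambda>i. v @ [i]) {1..}" by (auto simp: inj_on_def)
    then have "infinite ((\<lambda>i::nat. v @ [i]) ` {1..})"
      using finite_imageD infinite_Ici by blast
    then obtain i :: nat where "?P i"
      using fin finite_subset[of "(\<lambda>i::nat. v @ [i]) ` {1..}" t] by auto
    then have "?P (LEAST i. ?P i)" by (rule LeastI)
    then show ?thesis
      using False t v by (auto simp: tree_step_def add_child_def is_tree_def)
  qed
qed

end

theory Submission
  imports Defs
begin

text \<open>Conditionally on \<open>B\<^sub>n = b\<close>, the next value is \<open>2 (b + 1)\<close> with probability \<open>1 / (b + 1)\<close> and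
  \<open>b + 1\<close> otherwise, so the conditional \<open>k\<close>-th moment is the polynomial \<open>(b + 1)\<^bsup>k-1\<^esup> (b + 2\<^bsup>k\<^esup>)\<close>.
  Hence the increment of the \<open>k\<close>-th moment is \<open>k - 1 + 2\<^bsup>k\<^esup>\<close> times the \<open>(k-1)\<close>-st moment plus lower
  moments, and (a) follows by induction and the Stolz-Cesaro theorem. Parts (b) and (c) are Markov's
  inequality for the first moment. For (d), once \<open>\<eta> k \<ge> 2\<close> the sum over \<open>n\<close> of the \<open>k\<close>-th powers of
  \<open>B\<^sub>n / n\<^bsup>1+\<eta>\<^esup>\<close> has finite expectation, so its terms tend to 0 almost surely.\<close>

section \<open>The Stolz-Cesaro theorem and its case of powers of n\<close>

lemma Stolz_Cesaro_zero:
  fixes x y :: "nat \<Rightarrow> real"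
  assumes mono: "\<And>n. y n < y (Suc n)" and top: "filterlim y at_top sequentially"
    and lim: "(\<lambda>n. (x (Suc n) - x n) / (y (Suc n) - y n)) \<longlonglongrightarrow> 0"
  shows "(\<lambda>n. x n / y n) \<longlonglongrightarrow> 0"
proof (rule LIMSEQ_I)
  fix r :: real assume r: "0 < r"
  obtain N where N: "\<And>n. n \<ge> N \<Longrightarrow> \<bar>(x (Suc n) - x n) / (y (Suc n) - y n)\<bar> < r / 2"
    using LIMSEQ_D[OF lim, of "r / 2"] r by auto
  have incr: "\<bar>x (Suc n) - x n\<bar> \<le> r / 2 * (y (Suc n) - y n)" if "n \<ge> N" for n
    using N[OF that] mono[of n] by (simp add: abs_divide pos_divide_less_eq)
  \<comment> \<open>Telescoping: adding up \<open>incr\<close> from N to n collapses the increments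
    of y to \<open>y n - y N\<close>.\<close>
  have diff: "\<bar>x n - x N\<bar> \<le> r / 2 * (y n - y N)" if "n \<ge> N" for n
    using that
  proof (induction n rule: dec_induct)
    case (step n)
    then show ?case using incr[of n] by (simp add: right_diff_distrib)
  qed simp
  have "\<forall>\<^sub>F n in sequentially. y n > max 1 (2 * (\<bar>x N\<bar> + r / 2 * \<bar>y N\<bar>) / r)"
    using top unfolding filterlim_at_top_dense by blast
  \<comment> \<open>The bound 1 keeps \<open>y n\<close> positive for the division; the other bound
    makes the terms in \<open>x N\<close> and \<open>y N\<close> left over by \<open>diff\<close>
    smaller than \<open>r / 2 * y n\<close>.\<close>
  then obtain N' where N': "\<And>n. n \<ge> N' \<Longrightarrow> y n > 1 \<and> y n > 2 * (\<bar>x N\<bar> + r / 2 * \<bar>y N\<bar>) / r"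
    unfolding eventually_sequentially max_less_iff_conj by blast
  show "\<exists>no. \<forall>n\<ge>no. norm (x n / y n - 0) < r"
  proof (intro exI allI impI)
    fix n assume n: "n \<ge> max N N'"
    have y: "y n > 1" "2 * (\<bar>x N\<bar> + r / 2 * \<bar>y N\<bar>) < r * y n"
      using N'[of n] n r by (auto simp: field_simps)
    define c where "c = r * \<bar>y N\<bar>"
    have "- c \<le> r * y N"
      using r by (simp add: abs_if c_def)
    moreover have "2 * \<bar>x n - x N\<bar> \<le> r * y n - r * y N"
      using diff[of n] n by (simp add: right_diff_distrib)
    moreover have "2 * \<bar>x N\<bar> + c < r * y n"
      using y by (simp add: c_def)
    moreover have "\<bar>x n\<bar> \<le> \<bar>x N\<bar> + \<bar>x n - x N\<bar>"
      using abs_triangle_ineq[of "x N" "x n - x N"] by simp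
    ultimately have "\<bar>x n\<bar> < r * y n"
      by argo
    then show "norm (x n / y n - 0) < r"
      using y by (simp add: abs_divide pos_divide_less_eq)
  qed
qed

text \<open>Replacing x by x - l * y lowers both the quotient and the quotient of increments by l,
  which reduces the claim to the limit 0.\<close>

theorem Stolz_Cesaro:
  fixes x y :: "nat \<Rightarrow> real"
  assumes mono: "\<And>n. y n < y (Suc n)" and top: "filterlim y at_top sequentially"
    and lim: "(\<lambda>n. (x (Suc n) - x n) / (y (Suc n) - y n)) \<longlonglongrightarrow> l"
  shows "(\<lambda>n. x n / y n) \<longlonglongrightarrow> l"
proof -
  have "(\<lambda>n. ((x (Suc n) - l * y (Suc n)) - (x n - l * y n)) / (y (Suc n) - y n))
      = (\<lambda>n. (x (Suc n) - x n) / (y (Suc n) - y n) - l)"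
  proof
    fix n show "((x (Suc n) - l * y (Suc n)) - (x n - l * y n)) / (y (Suc n) - y n)
      = (x (Suc n) - x n) / (y (Suc n) - y n) - l"
      using mono[of n] by (simp add: field_simps)
  qed
  then have "(\<lambda>n. ((x (Suc n) - l * y (Suc n)) - (x n - l * y n)) / (y (Suc n) - y n)) \<longlonglongrightarrow> 0"
    using lim by (simp add: LIM_zero)
  then have "(\<lambda>n. (x n - l * y n) / y n) \<longlonglongrightarrow> 0"
    by (rule Stolz_Cesaro_zero[OF mono top])
  then have "(\<lambda>n. (x n - l * y n) / y n + l) \<longlonglongrightarrow> 0 + l"
    by (intro tendsto_intros)
  moreover have "\<forall>\<^sub>F n in sequentially. (x n - l * y n) / y n + l = x n / y n"
    using top[unfolded filterlim_at_top_dense, rule_format, of 0]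
    by eventually_elim (simp add: field_simps)
  ultimately show ?thesis
    by (simp add: tendsto_cong)
qed

text \<open>Stolz-Cesaro with n^(k+1) as denominator. Its increments are asymptotic to (k+1) n^k,
  which is where the division by \<open>Suc k\<close> comes from.\<close>

lemma Stolz_Cesaro_power:
  fixes x :: "nat \<Rightarrow> real"
  assumes "(\<lambda>n. (x (Suc n) - x n) / real n ^ k) \<longlonglongrightarrow> l"
  shows "(\<lambda>n. x n / real n ^ Suc k) \<longlonglongrightarrow> l / real (Suc k)"
proof (rule Stolz_Cesaro)
  show "filterlim (\<lambda>n. real n ^ Suc k) at_top sequentially"
    by (intro filterlim_pow_at_top filterlim_real_sequentially) simp
  \<comment> \<open>The difference of powers factors, with first factor (n+1) - n = 1. After
    division by n^k there remain k+1 terms (1 + 1/n)^p, each tending to 1.\<close>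
  have "(\<lambda>n. (real (Suc n) ^ Suc k - real n ^ Suc k) / real n ^ k) \<longlonglongrightarrow> real (Suc k)"
  proof -
    have "(\<lambda>n. \<Sum>p<Suc k. ((1 + 1 / real n) ^ p)) \<longlonglongrightarrow> (\<Sum>p<Suc k. (1 + 0) ^ p)"
      by (intro tendsto_intros lim_1_over_n)
    moreover have "\<forall>\<^sub>F n in sequentially. (\<Sum>p<Suc k. ((1 + 1 / real n) ^ p)) =
        (real (Suc n) ^ Suc k - real n ^ Suc k) / real n ^ k"
      using eventually_gt_at_top[of 0]
    proof eventually_elim
      fix n :: nat assume n: "n > 0"
      have "(real (Suc n) ^ Suc k - real n ^ Suc k)
          = (\<Sum>p<Suc k. real (Suc n) ^ p * real n ^ (k - p))"
        by (subst power_diff_sumr2) (simp add: lessThan_Suc mult.commute)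
      also have "\<dots> / real n ^ k = (\<Sum>p<Suc k. real (Suc n) ^ p * real n ^ (k - p) / real n ^ k)"
        by (rule sum_divide_distrib)
      also have "\<dots> = (\<Sum>p<Suc k. ((1 + 1 / real n) ^ p))"
      proof (rule sum.cong[OF refl])
        fix p assume "p \<in> {..<Suc k}"
        then have "real n ^ k = real n ^ p * real n ^ (k - p)"
          by (simp flip: power_add)
        moreover have "1 + 1 / real n = real (Suc n) / real n" using n by (simp add: field_simps)
        ultimately show "real (Suc n) ^ p * real n ^ (k - p) / real n ^ k = (1 + 1 / real n) ^ p"
          using n by (simp add: power_divide)
      qed
      finally show "(\<Sum>p<Suc k. ((1 + 1 / real n) ^ p)) =
        (real (Suc n) ^ Suc k - real n ^ Suc k) / real n ^ k" by simp
    qed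
    ultimately show ?thesis by (simp add: tendsto_cong)
  qed
  from tendsto_divide[OF assms this]
  have "(\<lambda>n. ((x (Suc n) - x n) / real n ^ k) / ((real (Suc n) ^ Suc k - real n ^ Suc k) / real n ^ k))
      \<longlonglongrightarrow> l / real (Suc k)" by simp
  moreover have "\<forall>\<^sub>F n in sequentially.
      ((x (Suc n) - x n) / real n ^ k) / ((real (Suc n) ^ Suc k - real n ^ Suc k) / real n ^ k)
      = (x (Suc n) - x n) / (real (Suc n) ^ Suc k - real n ^ Suc k)"
    using eventually_gt_at_top[of 0] by eventually_elim simp
  ultimately show "(\<lambda>n. (x (Suc n) - x n) / (real (Suc n) ^ Suc k - real n ^ Suc k)) \<longlonglongrightarrow> l / real (Suc k)"
    by (rule Lim_transform_eventually)
qed (simp only: power_strict_mono of_nat_less_iff lessI of_nat_0_le_iff zero_less_Suc)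

section \<open>Limiting moments and the asymptotics forced by the moment recurrence\<close>

lemma moment_limit_Suc:
  "moment_limit (Suc k) = (real k + 2 ^ Suc k) * moment_limit k / real (Suc k)"
proof -
  have "1 - 1 / real (Suc k) + 2 ^ Suc k / real (Suc k) = (real k + 2 ^ Suc k) / real (Suc k)"
    by (simp add: diff_divide_eq_iff flip: add_divide_distrib del: power_Suc)
  then show ?thesis
    unfolding moment_limit_def by (simp only: prod.nat_ivl_Suc' le_add1 plus_1_eq_Suc) simp
qed

text \<open>Each factor equals 2^i / i * (1 + (i-1) / 2^i). The exponents of 2 add up to a
  triangular number, the denominators multiply to \<open>fact k\<close>.\<close>

lemma moment_limit_eq:
  "moment_limit k = 2 ^ (k * (k + 1) div 2) / fact k * (\<Prod>i=1..k. 1 + (real i - 1) / 2 ^ i)"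
proof (induction k)
  case 0
  show ?case by (simp add: moment_limit_def)
next
  case (Suc k)
  have "Suc k * (Suc k + 1) div 2 = k * (k + 1) div 2 + Suc k"
    by simp
  then have "(2::real) ^ (Suc k * (Suc k + 1) div 2) = 2 ^ (k * (k + 1) div 2) * 2 ^ Suc k"
    by (simp only: power_add)
  moreover have "real k + 2 ^ Suc k = 2 ^ Suc k * (1 + real k / 2 ^ Suc k)"
    by (simp add: field_simps)
  ultimately show ?case
    unfolding moment_limit_Suc Suc.IH by (simp only: prod.nat_ivl_Suc' le_add1 plus_1_eq_Suc fact_Suc of_nat_mult)
      (simp del: power_Suc add: mult_ac)
qed

text \<open>The purely analytic part of (a). The top term of the recurrence is the moment of the
  same order at time n, so the increment involves lower orders only and strong induction on the
  order applies.\<close>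

lemma moment_recurrence_limit:
  fixes \<mu> :: "nat \<Rightarrow> nat \<Rightarrow> real"
  assumes zero: "\<And>n. \<mu> 0 n = 1"
    and rec: "\<And>k n. \<mu> (Suc k) (Suc n)
      = (\<Sum>j\<le>k. real (k choose j) * (\<mu> (Suc j) n + 2 ^ Suc k * \<mu> j n))"
  shows "(\<lambda>n. \<mu> k n / real n ^ k) \<longlonglongrightarrow> moment_limit k"
proof (induction k rule: less_induct)
  case (less k)
  show ?case
  proof (cases k)
    case 0
    then show ?thesis by (simp add: zero moment_limit_def)
  next
    case (Suc m)
    \<comment> \<open>After division by n^m only the order m survives: a lower order j keeps an
      extra factor (1/n)^(m-j), which tends to 0.\<close>
    have lim: "(\<lambda>n. \<mu> j n / real n ^ m) \<longlonglongrightarrow> (if j = m then moment_limit m else 0)"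
      if "j \<le> m" for j
    proof (cases "j = m")
      case True
      then show ?thesis using less[of m] Suc by simp
    next
      case False
      have "(\<lambda>n. (\<mu> j n / real n ^ j) * (1 / real n) ^ (m - j)) \<longlonglongrightarrow> moment_limit j * 0 ^ (m - j)"
        using less[of j] Suc that by (intro tendsto_intros lim_1_over_n) auto
      moreover have "(\<mu> j n / real n ^ j) * (1 / real n) ^ (m - j) = \<mu> j n / real n ^ m" for n
      proof -
        have "real n ^ m = real n ^ j * real n ^ (m - j)"
          using that by (simp flip: power_add)
        then show ?thesis by (simp add: power_one_over field_simps)
      qed
      ultimately show ?thesis using False that by (simp add: power_0_left)
    qed
    \<comment> \<open>The summand j = m of the first sum is exactly \<open>\<mu> k n\<close> and
      cancels, hence the range j < m.\<close>
    have "\<mu> k (Suc n) - \<mu> k n = (\<Sum>j<m. real (m choose j) * \<mu> (Suc j) n)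
        + 2 ^ k * (\<Sum>j\<le>m. real (m choose j) * \<mu> j n)" for n
      unfolding Suc rec
      by (simp add: sum.distrib distrib_left sum_distrib_left mult_ac flip: lessThan_Suc_atMost)
    then have "(\<mu> k (Suc n) - \<mu> k n) / real n ^ m = (\<Sum>j<m. real (m choose j) * (\<mu> (Suc j) n / real n ^ m))
        + 2 ^ k * (\<Sum>j\<le>m. real (m choose j) * (\<mu> j n / real n ^ m))" for n
      by (simp only: add_divide_distrib sum_divide_distrib times_divide_eq_right[symmetric])
    moreover have "(\<lambda>n. (\<Sum>j<m. real (m choose j) * (\<mu> (Suc j) n / real n ^ m))
        + 2 ^ k * (\<Sum>j\<le>m. real (m choose j) * (\<mu> j n / real n ^ m)))
      \<longlonglongrightarrow> (\<Sum>j<m. real (m choose j) * (if Suc j = m then moment_limit m else 0))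
        + 2 ^ k * (\<Sum>j\<le>m. real (m choose j) * (if j = m then moment_limit m else 0))"
      by (intro tendsto_intros lim) auto
    \<comment> \<open>The only surviving index is j = m - 1, with binomial coefficient m; for m = 0
      the sum is empty and both sides vanish.\<close>
    moreover have "(\<Sum>j<m. real (m choose j) * (if Suc j = m then moment_limit m else 0))
        = real m * moment_limit m"
      by (cases m) (simp_all add: if_distrib cong: if_cong)
    moreover have "(\<Sum>j\<le>m. real (m choose j) * (if j = m then moment_limit m else 0)) = moment_limit m"
      by (simp add: if_distrib cong: if_cong)
    ultimately have "(\<lambda>n. (\<mu> k (Suc n) - \<mu> k n) / real n ^ m)
        \<longlonglongrightarrow> real m * moment_limit m + 2 ^ k * moment_limit m"
      by (simp only:)
    \<comment> \<open>The increment limit (m + 2^(m+1)) times \<open>moment_limit m\<close>, divided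
      by m + 1, is the recursion \<open>moment_limit_Suc\<close>.\<close>
    from Stolz_Cesaro_power[OF this] show ?thesis
      by (simp add: Suc moment_limit_Suc distrib_right)
  qed
qed

section \<open>Explicit law of the sequence of chosen nodes\<close>

definition tree_of :: "nat list list \<Rightarrow> nat list set" where
  "tree_of us = foldl tree_step {[]} us"

lemma tree_of_Nil [simp]: "tree_of [] = {[]}"
  and tree_of_snoc [simp]: "tree_of (us @ [v]) = tree_step (tree_of us) v"
  by (simp_all add: tree_of_def)

text \<open>A concrete model of the first n choices, oldest first. It records nodes instead of trees
  because \<open>uniform_node\<close> conditions on both, and the nodes determine the trees.\<close>

primrec history_law :: "nat \<Rightarrow> nat list list pmf" where
  "history_law 0 = return_pmf []"
| "history_law (Suc n) =
    bind_pmf (history_law n) (\<lambda>us. map_pmf (\<lambda>v. us @ [v]) (pmf_of_set (tree_of us)))"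

text \<open>A list determines its last entry and the rest, so only the prefix \<open>us\<close>
  contributes to the bind. This is the chain rule that the process is later shown to obey.\<close>

lemma pmf_history_law_snoc:
  "pmf (history_law (Suc n)) (us @ [v]) = pmf (history_law n) us * pmf (pmf_of_set (tree_of us)) v"
proof -
  have "pmf (map_pmf (\<lambda>v. us' @ [v]) (pmf_of_set (tree_of us'))) (us @ [v])
      = indicator {us} us' * pmf (pmf_of_set (tree_of us)) v" for us'
  proof (cases "us' = us")
    case True
    have "inj (\<lambda>v. us @ [v])" by (auto simp: inj_def)
    from pmf_map_inj'[OF this] show ?thesis using True by simp
  next
    case False
    then show ?thesis by (auto simp: pmf_eq_0_set_pmf)
  qed
  then show ?thesis
    by (simp add: pmf_bind measure_pmf_single)
qed

text \<open>Finite support turns expectations into finite sums and makes every function integrable.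
  The claims are proved together: the next support is finite because the trees are, and the next
  trees are good because the chosen node lies in the tree.\<close>

lemma history_law_support:
  "finite (set_pmf (history_law n)) \<and>
   (\<forall>us \<in> set_pmf (history_law n). finite (tree_of us) \<and> is_tree (tree_of us))"
proof (induction n)
  case 0
  show ?case by (auto simp: is_tree_def)
next
  case (Suc n)
  then have set: "set_pmf (pmf_of_set (tree_of us)) = tree_of us" if "us \<in> set_pmf (history_law n)" for us
    using that by (intro set_pmf_of_set) (auto simp: is_tree_def)
  show ?case
    using Suc set by (auto simp: tree_step_preserves)
qed

lemmas finite_history_law = history_law_support[THEN conjunct1]
  and tree_of_history = history_law_support[THEN conjunct2, rule_format]

section \<open>Node counts after one step and the moment recurrence\<close>

lemma nonroot_count_nonneg:
  assumes "finite t" "is_tree t"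
  shows "nonroot_count t \<ge> 0"
proof -
  have "card t > 0" using assms by (auto simp: card_gt_0_iff is_tree_def)
  then show ?thesis by (simp add: nonroot_count_def)
qed

lemma nonroot_count_double_tree:
  assumes "finite t"
  shows "nonroot_count (double_tree t) = 2 * (nonroot_count t + 1)"
proof -
  have eq: "double_tree t = insert [] ((#) 1 ` t \<union> (#) 2 ` t)"
    by (auto simp: double_tree_def)
  have "card ((#) 1 ` t \<union> (#) 2 ` t) = card t + card t"
    using assms by (subst card_Un_disjoint) (auto simp: card_image)
  then have "card (double_tree t) = Suc (card t + card t)"
    unfolding eq using assms by (subst card_insert_disjoint) auto
  then show ?thesis by (simp add: nonroot_count_def)
qed

text \<open>A finite t cannot contain all of the infinitely many words v i, so the
  \<open>LEAST\<close> is attained and the added word is new.\<close>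

lemma nonroot_count_add_child:
  assumes "finite t"
  shows "nonroot_count (add_child t v) = nonroot_count t + 1"
proof -
  let ?P = "\<lambda>i. 1 \<le> i \<and> v @ [i] \<notin> t"
  have "inj_on (\<lambda>i. v @ [i]) {1..}" by (auto simp: inj_on_def)
  then have "infinite ((\<lambda>i::nat. v @ [i]) ` {1..})"
    using finite_imageD infinite_Ici by blast
  then obtain i :: nat where "?P i"
    using assms finite_subset[of "(\<lambda>i::nat. v @ [i]) ` {1..}" t] by auto
  then have "?P (LEAST i. ?P i)" by (rule LeastI)
  then show ?thesis
    using assms by (simp add: add_child_def nonroot_count_def)
qed

definition moment :: "nat \<Rightarrow> nat \<Rightarrow> real" where
  "moment k n = measure_pmf.expectation (history_law n) (\<lambda>us. nonroot_count (tree_of us) ^ k)"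

text \<open>The conditional moment given the tree, with b non-root nodes. The root contributes (2
  (b+1))^(k+1) and each of the b other nodes (b+1)^(k+1); the common factor b+1 cancels against the
  number of nodes.\<close>

lemma sum_tree_step:
  assumes "finite t" "is_tree t"
  shows "(\<Sum>v\<in>t. nonroot_count (tree_step t v) ^ Suc k) / card t
    = (nonroot_count t + 1) ^ k * (nonroot_count t + 2 ^ Suc k)"
proof -
  let ?b = "nonroot_count t"
  have root: "[] \<in> t" using assms by (simp add: is_tree_def)
  have card: "real (card t) = ?b + 1" by (simp add: nonroot_count_def)
  have pos: "?b + 1 > 0" using nonroot_count_nonneg[OF assms] by simp
  have "(\<Sum>v\<in>t. nonroot_count (tree_step t v) ^ Suc k)
      = nonroot_count (tree_step t []) ^ Suc k + (\<Sum>v\<in>t - {[]}. nonroot_count (tree_step t v) ^ Suc k)"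
    by (rule sum.remove[OF assms(1) root])
  also have "\<dots> = (2 * (?b + 1)) ^ Suc k + (\<Sum>v\<in>t - {[]}. (?b + 1) ^ Suc k)"
    using assms by (intro arg_cong2[where f="(+)"] sum.cong)
      (auto simp: tree_step_def nonroot_count_double_tree nonroot_count_add_child)
  also have "(\<Sum>v\<in>t - {[]}. (?b + 1) ^ Suc k) = ?b * (?b + 1) ^ Suc k"
    using root assms pos card by (simp add: card_Diff_singleton of_nat_diff Suc_leI)
  also have "(2 * (?b + 1)) ^ Suc k + ?b * (?b + 1) ^ Suc k
      = ((?b + 1) ^ k * (?b + 2 ^ Suc k)) * (?b + 1)"
    by (simp only: power_mult_distrib) (simp add: algebra_simps)
  finally show ?thesis using pos by (simp add: card del: power_Suc)
qed

lemma moment_0 [simp]: "moment 0 n = 1"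
  by (simp add: moment_def)

text \<open>Condition on the first n choices, insert \<open>sum_tree_step\<close>, and expand
  (b+1)^k binomially so that the expectation becomes linear in moments at time n.\<close>

lemma moment_Suc:
  "moment (Suc k) (Suc n)
    = (\<Sum>j\<le>k. real (k choose j) * (moment (Suc j) n + 2 ^ Suc k * moment j n))"
proof -
  let ?b = "\<lambda>us. nonroot_count (tree_of us)" and ?A = "set_pmf (history_law n)"
  have set: "tree_of us \<noteq> {}" "finite (tree_of us)" if "us \<in> ?A" for us
    using tree_of_history[OF that] by (auto simp: is_tree_def)
  have "moment (Suc k) (Suc n) = (\<Sum>us\<in>?A. pmf (history_law n) us *\<^sub>R
      measure_pmf.expectation (map_pmf (\<lambda>v. us @ [v]) (pmf_of_set (tree_of us))) (\<lambda>us. ?b us ^ Suc k))"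
    unfolding moment_def history_law.simps
    by (rule pmf_expectation_bind) (auto simp: finite_history_law set)
  also have "\<dots> = (\<Sum>us\<in>?A. pmf (history_law n) us *\<^sub>R
      (\<Sum>j\<le>k. real (k choose j) * (?b us ^ Suc j + 2 ^ Suc k * ?b us ^ j)))"
  proof (rule sum.cong[OF refl])
    fix us assume us: "us \<in> ?A"
    have "(?b us + 1) ^ k * (?b us + 2 ^ Suc k)
        = (\<Sum>j\<le>k. real (k choose j) * (?b us ^ Suc j + 2 ^ Suc k * ?b us ^ j))"
      by (subst binomial_ring) (simp add: sum_distrib_left sum_distrib_right algebra_simps)
    then show "pmf (history_law n) us *\<^sub>R
        measure_pmf.expectation (map_pmf (\<lambda>v. us @ [v]) (pmf_of_set (tree_of us))) (\<lambda>us. ?b us ^ Suc k)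
      = pmf (history_law n) us *\<^sub>R
        (\<Sum>j\<le>k. real (k choose j) * (?b us ^ Suc j + 2 ^ Suc k * ?b us ^ j))"
      using sum_tree_step[of "tree_of us" k] tree_of_history[OF us]
      by (simp add: integral_pmf_of_set set[OF us] del: power_Suc)
  qed
  also have "\<dots> = measure_pmf.expectation (history_law n)
      (\<lambda>us. \<Sum>j\<le>k. real (k choose j) * (?b us ^ Suc j + 2 ^ Suc k * ?b us ^ j))"
    by (rule integral_measure_pmf[OF finite_history_law, symmetric]) auto
  also have "\<dots> = (\<Sum>j\<le>k. real (k choose j) * (moment (Suc j) n + 2 ^ Suc k * moment j n))"
    unfolding moment_def
    by (simp add: integrable_measure_pmf_finite finite_history_law del: power_Suc)
  finally show ?thesis .
qed

lemma moment_asymp: "(\<lambda>n. moment k n / real n ^ k) \<longlonglongrightarrow> moment_limit k"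
  by (rule moment_recurrence_limit) (simp_all only: moment_0 moment_Suc)

text \<open>Convergent sequences are bounded. This bound, uniform in n, supplies the constants in
  the estimates for (b), (c) and (d).\<close>

lemma moment_bound:
  obtains C where "C > 0" "\<And>n. moment k n / real n ^ k \<le> C"
proof -
  have "Bseq (\<lambda>n. moment k n / real n ^ k)"
    using moment_asymp convergentI convergent_imp_Bseq by blast
  then obtain C where "C > 0" "\<And>n. norm (moment k n / real n ^ k) \<le> C"
    by (auto elim: BseqE)
  then show ?thesis by (intro that[of C]) (auto intro: order_trans[OF abs_ge_self])
qed

section \<open>Transfer from the process to the explicit law\<close>

context doubling_tree_process
begin

definition history :: "nat \<Rightarrow> 'w \<Rightarrow> nat list list" where
  "history n \<omega> = map (\<lambda>i. \<nu> i \<omega>) [0..<n]"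

lemma history_Suc: "history (Suc n) \<omega> = history n \<omega> @ [\<nu> n \<omega>]"
  by (simp add: history_def)

lemma tree_eq_tree_of:
  assumes "\<omega> \<in> space M"
  shows "\<tau> n \<omega> = tree_of (history n \<omega>)"
proof (induction n)
  case 0
  show ?case using assms by (simp add: tree_0 history_def)
next
  case (Suc n)
  then show ?case using assms by (simp add: tree_Suc history_Suc)
qed

lemma take_history: "i \<le> n \<Longrightarrow> take i (history n \<omega>) = history i \<omega>"
  by (simp add: history_def take_map)

lemma history_eq_iff:
  "history n \<omega> = us \<longleftrightarrow> length us = n \<and> (\<forall>i<n. \<nu> i \<omega> = us ! i)"
  by (auto simp: history_def list_eq_iff_nth_eq)

lemma measurable_history [measurable]: "history n \<in> measurable M (count_space UNIV)"
proof (subst measurable_count_space_eq_countable; (intro conjI ballI)?)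
  fix us :: "nat list list"
  note random_node [measurable]
  have "history n -` {us} \<inter> space M = {\<omega> \<in> space M. length us = n \<and> (\<forall>i<n. \<nu> i \<omega> = us ! i)}"
    unfolding history_eq_iff[symmetric] by auto
  also have "\<dots> \<in> events" by measurable
  finally show "history n -` {us} \<inter> space M \<in> events" .
qed auto

text \<open>Induction on n: \<open>uniform_node\<close> gives the process the same chain rule as
  \<open>pmf_history_law_snoc\<close>.\<close>

lemma measure_history: "\<P>(\<omega> in M. history n \<omega> = us) = pmf (history_law n) us"
proof (induction n arbitrary: us)
  case 0
  show ?case by (cases "us = []") (auto simp: history_def prob_space)
next
  case (Suc n)
  show ?case
  proof (cases us rule: rev_cases)
    case Nil
    then show ?thesis by (auto simp: history_Suc pmf_eq_0_set_pmf)
  next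
    case (snoc us' v)
    \<comment> \<open>This is the conditioning event of \<open>uniform_node\<close>; the trees are determined by the chosen nodes.\<close>
    define past where "past \<omega> \<longleftrightarrow>
      (\<forall>i\<le>n. \<tau> i \<omega> = tree_of (take i us')) \<and> (\<forall>i<n. \<nu> i \<omega> = us' ! i)" for \<omega>
    show ?thesis
    proof (cases "length us' = n")
      case True
      have past: "past \<omega> \<longleftrightarrow> history n \<omega> = us'" if "\<omega> \<in> space M" for \<omega>
      proof
        assume "past \<omega>" then show "history n \<omega> = us'"
          by (simp add: past_def history_eq_iff True)
      next
        assume "history n \<omega> = us'" then show "past \<omega>"
          using that take_history[of _ n \<omega>] history_eq_iff[of n \<omega> us']
          by (simp add: past_def tree_eq_tree_of)
      qed
      have Pp: "\<P>(\<omega> in M. past \<omega>) = pmf (history_law n) us'"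
        unfolding Suc.IH[symmetric] by (intro arg_cong[where f=prob]) (auto simp: past)
      have J: "\<P>(\<omega> in M. history (Suc n) \<omega> = us) = \<P>(\<omega> in M. \<nu> n \<omega> = v \<and> past \<omega>)"
        by (intro arg_cong[where f=prob]) (auto simp: past history_Suc snoc)
      show ?thesis
      proof (cases "\<P>(\<omega> in M. past \<omega>) > 0")
        case pos: True
        have "\<P>(\<omega> in M. \<nu> n \<omega> = v \<and> past \<omega>) / \<P>(\<omega> in M. past \<omega>) = pmf (pmf_of_set (tree_of us')) v"
          using uniform_node[of n "\<lambda>i. tree_of (take i us')" "\<lambda>i. us' ! i" v] pos True
          by (simp add: past_def cond_prob_def)
        then show ?thesis using pos
          unfolding J unfolding snoc pmf_history_law_snoc Pp by (simp add: field_simps)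
      next
        case False
        \<comment> \<open>On a null past \<open>uniform_node\<close> says nothing, but by
          monotonicity both sides of the claim are 0.\<close>
        then have zero: "\<P>(\<omega> in M. past \<omega>) = 0"
          by (simp add: order.order_iff_strict zero_less_measure_iff)
        have "\<P>(\<omega> in M. \<nu> n \<omega> = v \<and> past \<omega>) \<le> \<P>(\<omega> in M. past \<omega>)"
        proof (rule finite_measure_mono)
          have "{\<omega> \<in> space M. past \<omega>} = {\<omega> \<in> space M. history n \<omega> = us'}"
            by (auto simp: past)
          then show "{\<omega> \<in> space M. past \<omega>} \<in> events" by simp
        qed auto
        then have "\<P>(\<omega> in M. \<nu> n \<omega> = v \<and> past \<omega>) = 0"
          using zero by (simp add: measure_le_0_iff)
        then show ?thesis using Pp zero unfolding J unfolding snoc pmf_history_law_snoc by simp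
      qed
    next
      case False
      \<comment> \<open>A list of the wrong length is never a history, so both events are empty; the
        induction hypothesis, read backwards, makes the pmf of \<open>us'\<close> vanish
        too.\<close>
      then have "\<P>(\<omega> in M. history n \<omega> = us') = 0" "\<P>(\<omega> in M. history (Suc n) \<omega> = us) = 0"
        unfolding history_eq_iff snoc by auto
      then show ?thesis by (simp only: snoc pmf_history_law_snoc flip: Suc.IH)
    qed
  qed
qed

text \<open>Lists of words form a countable type, so the point masses from
  \<open>measure_history\<close> determine the whole law.\<close>

lemma distr_history: "distr M (count_space UNIV) (history n) = measure_pmf (history_law n)"
proof (rule measure_eqI_countable[of _ UNIV])
  fix us
  have "emeasure (distr M (count_space UNIV) (history n)) {us}
      = ennreal (\<P>(\<omega> in M. history n \<omega> = us))"
    by (simp add: emeasure_distr emeasure_eq_measure vimage_def Int_def conj_commute)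
  then show "emeasure (distr M (count_space UNIV) (history n)) {us}
      = emeasure (measure_pmf (history_law n)) {us}"
    by (simp add: measure_history emeasure_pmf_single)
qed auto

text \<open>No condition on f is needed: every function on a discrete space is measurable, and
  finite support gives integrability.\<close>

lemma
  fixes f :: "nat list set \<Rightarrow> real"
  shows tree_borel: "(\<lambda>\<omega>. f (\<tau> n \<omega>)) \<in> borel_measurable M"
    and tree_integrable: "integrable M (\<lambda>\<omega>. f (\<tau> n \<omega>))"
    and tree_expectation: "expectation (\<lambda>\<omega>. f (\<tau> n \<omega>))
      = measure_pmf.expectation (history_law n) (\<lambda>us. f (tree_of us))"
proof -
  have "(\<lambda>\<omega>. f (tree_of (history n \<omega>))) \<in> borel_measurable M" by measurable
  then show "(\<lambda>\<omega>. f (\<tau> n \<omega>)) \<in> borel_measurable M"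
    by (simp add: tree_eq_tree_of cong: measurable_cong)
  have "integrable (distr M (count_space UNIV) (history n)) (\<lambda>us. f (tree_of us))"
    unfolding distr_history by (simp add: integrable_measure_pmf_finite finite_history_law)
  then have "integrable M (\<lambda>\<omega>. f (tree_of (history n \<omega>)))"
    by (simp add: integrable_distr_eq)
  then show "integrable M (\<lambda>\<omega>. f (\<tau> n \<omega>))"
    by (simp add: tree_eq_tree_of cong: Bochner_Integration.integrable_cong)
  have "expectation (\<lambda>\<omega>. f (\<tau> n \<omega>)) = expectation (\<lambda>\<omega>. f (tree_of (history n \<omega>)))"
    by (simp add: tree_eq_tree_of cong: Bochner_Integration.integral_cong)
  also have "\<dots> = integral\<^sup>L (distr M (count_space UNIV) (history n)) (\<lambda>us. f (tree_of us))"
    by (simp add: integral_distr)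
  finally show "expectation (\<lambda>\<omega>. f (\<tau> n \<omega>))
      = measure_pmf.expectation (history_law n) (\<lambda>us. f (tree_of us))"
    by (simp only: distr_history)
qed

section \<open>Moments, tightness and convergence for the non-root count\<close>

definition B :: "nat \<Rightarrow> 'w \<Rightarrow> real" where
  "B n \<omega> = nonroot_count (\<tau> n \<omega>)"

lemma borel_measurable_B [measurable]: "B n \<in> borel_measurable M"
  unfolding B_def by (rule tree_borel)

lemma integrable_B_power: "integrable M (\<lambda>\<omega>. B n \<omega> ^ k)"
  unfolding B_def by (rule tree_integrable)

lemma expectation_B_power: "expectation (\<lambda>\<omega>. B n \<omega> ^ k) = moment k n"
  unfolding B_def moment_def by (rule tree_expectation)

text \<open>Transferred from the support of \<open>history_law\<close>, where the trees are finite
  and well formed; hence an almost sure statement.\<close>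

lemma AE_B_nonneg: "AE \<omega> in M. B n \<omega> \<ge> 0"
proof -
  have "AE us in distr M (count_space UNIV) (history n). nonroot_count (tree_of us) \<ge> 0"
    unfolding distr_history by (intro AE_pmfI nonroot_count_nonneg) (auto simp: tree_of_history)
  then have "AE \<omega> in M. nonroot_count (tree_of (history n \<omega>)) \<ge> 0"
    by (simp add: AE_distr_iff)
  then show ?thesis by (simp add: B_def tree_eq_tree_of cong: AE_cong)
qed

lemma moments_converge:
  "(\<lambda>n. expectation (\<lambda>\<omega>. (B n \<omega> / real n) ^ k)) \<longlonglongrightarrow> moment_limit k"
  using moment_asymp by (simp add: power_divide expectation_B_power)

lemma Markov_B:
  assumes "a > 0"
  shows "\<P>(\<omega> in M. B n \<omega> \<ge> a) \<le> moment 1 n / a"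
  using integral_Markov_inequality_measure[of M "B n" "{}" a] integrable_B_power[of n 1]
    expectation_B_power[of n 1] AE_B_nonneg[of n] assms
  by simp

lemma tight_B: "tight (\<lambda>n. distr M borel (\<lambda>\<omega>. B (Suc n) \<omega> / real (Suc n)))"
  unfolding tight_def
proof (intro conjI allI impI)
  fix n show "real_distribution (distr M borel (\<lambda>\<omega>. B (Suc n) \<omega> / real (Suc n)))"
    by (intro real_distribution_distr) simp
next
  fix \<epsilon> :: real assume \<epsilon>: "\<epsilon> > 0"
  obtain C where C: "C > 0" "\<And>n. moment 1 n / real n ^ 1 \<le> C"
    using moment_bound[of 1] by blast
  \<comment> \<open>With this b, Markov's inequality bounds the upper tail by C / b = \<epsilon> /
    2.\<close>
  define b where "b = 2 * C / \<epsilon>"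
  have b: "b > 0" using C \<epsilon> by (simp add: b_def)
  \<comment> \<open>Tightness asks for intervals open on the left; the endpoint -1 loses no mass,
    since the values are almost surely nonnegative.\<close>
  have "measure (distr M borel (\<lambda>\<omega>. B (Suc n) \<omega> / real (Suc n))) {-1<..b} > 1 - \<epsilon>" for n
  proof -
    let ?Y = "\<lambda>\<omega>. B (Suc n) \<omega> / real (Suc n)"
    have "\<P>(\<omega> in M. \<not> ?Y \<omega> \<in> {-1<..b}) \<le> \<P>(\<omega> in M. B (Suc n) \<omega> \<ge> b * real (Suc n))"
    proof (rule finite_measure_mono_AE)
      show "AE \<omega> in M. \<omega> \<in> {\<omega> \<in> space M. \<not> ?Y \<omega> \<in> {-1<..b}}
          \<longrightarrow> \<omega> \<in> {\<omega> \<in> space M. B (Suc n) \<omega> \<ge> b * real (Suc n)}"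
        using AE_B_nonneg[of "Suc n"]
      proof eventually_elim
        case (elim \<omega>)
        then have "?Y \<omega> > -1" by (simp add: field_simps)
        then show ?case by (auto simp: field_simps)
      qed
    qed simp
    also have "\<dots> \<le> moment 1 (Suc n) / (b * real (Suc n))"
      using b by (intro Markov_B) simp
    also have "\<dots> = (moment 1 (Suc n) / real (Suc n) ^ 1) / b"
      by simp
    also have "\<dots> \<le> C / b"
      using C(2)[of "Suc n"] b by (intro divide_right_mono) auto
    also have "\<dots> < \<epsilon>"
      using C \<epsilon> by (simp add: b_def)
    finally have "\<P>(\<omega> in M. \<not> ?Y \<omega> \<in> {-1<..b}) < \<epsilon>" .
    moreover have "\<P>(\<omega> in M. \<not> ?Y \<omega> \<in> {-1<..b}) = 1 - \<P>(\<omega> in M. ?Y \<omega> \<in> {-1<..b})"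
      by (rule prob_neg) measurable
    moreover have "measure (distr M borel ?Y) {-1<..b} = \<P>(\<omega> in M. ?Y \<omega> \<in> {-1<..b})"
      by (subst measure_distr) (auto intro!: arg_cong[where f=prob])
    ultimately show ?thesis by simp
  qed
  then show "\<exists>a b. a < b \<and> (\<forall>n. 1 - \<epsilon> < measure (distr M borel (\<lambda>\<omega>. B (Suc n) \<omega> / real (Suc n))) {a<..b})"
    using b by (intro exI[of _ "-1"] exI[of _ b]) auto
qed

lemma B_over_superlinear_in_prob:
  fixes w :: "nat \<Rightarrow> real"
  assumes w: "(\<lambda>n. real n) \<in> o(w)"
  shows "tendsto_in_prob M (\<lambda>n \<omega>. B n \<omega> / w n) 0"
  unfolding tendsto_in_prob_def
proof (intro allI impI)
  fix \<epsilon> :: real assume \<epsilon>: "\<epsilon> > 0"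
  obtain C where C: "C > 0" "\<And>n. moment 1 n / real n ^ 1 \<le> C"
    using moment_bound[of 1] by blast
  have bound: "\<P>(\<omega> in M. \<bar>B n \<omega> / w n - 0\<bar> > \<epsilon>) \<le> C / \<epsilon> * \<bar>real n / w n\<bar>" if n: "n > 0" for n
  proof (cases "w n = 0")
    case True
    \<comment> \<open>Division by zero yields 0, so the event is empty.\<close>
    then show ?thesis using \<epsilon> by simp
  next
    case False
    have "\<P>(\<omega> in M. \<bar>B n \<omega> / w n - 0\<bar> > \<epsilon>) \<le> \<P>(\<omega> in M. B n \<omega> \<ge> \<epsilon> * \<bar>w n\<bar>)"
    proof (rule finite_measure_mono_AE)
      show "AE \<omega> in M. \<omega> \<in> {\<omega> \<in> space M. \<bar>B n \<omega> / w n - 0\<bar> > \<epsilon>}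
          \<longrightarrow> \<omega> \<in> {\<omega> \<in> space M. B n \<omega> \<ge> \<epsilon> * \<bar>w n\<bar>}"
        using AE_B_nonneg[of n] by eventually_elim (auto simp: False abs_divide pos_less_divide_eq)
    qed simp
    also have "\<dots> \<le> moment 1 n / (\<epsilon> * \<bar>w n\<bar>)"
      using \<epsilon> False by (intro Markov_B) simp
    also have "\<dots> = (moment 1 n / real n ^ 1) * (real n / (\<epsilon> * \<bar>w n\<bar>))"
      using n by simp
    also have "\<dots> \<le> C * (real n / (\<epsilon> * \<bar>w n\<bar>))"
      using C(2)[of n] \<epsilon> by (intro mult_right_mono) auto
    finally show ?thesis by (simp add: abs_divide)
  qed
  have "(\<lambda>n. C / \<epsilon> * \<bar>real n / w n\<bar>) \<longlonglongrightarrow> C / \<epsilon> * \<bar>0\<bar>"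
    by (intro tendsto_intros smalloD_tendsto[OF w])
  then have "(\<lambda>n. C / \<epsilon> * \<bar>real n / w n\<bar>) \<longlonglongrightarrow> 0" by simp
  then show "(\<lambda>n. \<P>(\<omega> in M. \<bar>B n \<omega> / w n - 0\<bar> > \<epsilon>)) \<longlonglongrightarrow> 0"
  proof (rule tendsto_sandwich[OF _ _ tendsto_const, rotated 2])
    show "\<forall>\<^sub>F n in sequentially. \<P>(\<omega> in M. \<bar>B n \<omega> / w n - 0\<bar> > \<epsilon>) \<le> C / \<epsilon> * \<bar>real n / w n\<bar>"
      using eventually_gt_at_top[of 0] by eventually_elim (rule bound)
  qed simp
qed

lemma B_over_power_AE:
  assumes \<eta>: "\<eta> > 0"
  shows "AE \<omega> in M. (\<lambda>n. B n \<omega> / real n powr (1 + \<eta>)) \<longlonglongrightarrow> 0"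
proof -
  \<comment> \<open>This makes \<eta> k at least 2, so that n^(-\<eta> k) is dominated by the
    summable n^(-2).\<close>
  define k where "k = nat \<lceil>2 / \<eta>\<rceil>"
  have "2 / \<eta> \<le> real k" unfolding k_def by (rule real_nat_ceiling_ge)
  then have k: "\<eta> * real k \<ge> 2" using \<eta> by (simp add: field_simps)
  then have k0: "k > 0" by (cases k) auto
  obtain C where C: "C > 0" "\<And>n. moment k n / real n ^ k \<le> C"
    using moment_bound[of k] by blast
  let ?Y = "\<lambda>n \<omega>. (B n \<omega> / real n powr (1 + \<eta>)) ^ k"
  have exp: "expectation (?Y n) \<le> C * (1 / real n ^ 2)" for n
  proof (cases "n = 0")
    case True
    \<comment> \<open>At n = 0 the quotient is 0 by convention, and its k-th power is 0 because k >
      0.\<close>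
    then show ?thesis using k0 by (simp add: power_0_left)
  next
    case False
    have "real n powr 2 \<le> real n powr (\<eta> * real k)"
      using k False by (intro powr_mono) auto
    then have le: "real n ^ 2 \<le> real n powr (\<eta> * real k)"
      using False by (simp add: powr_numeral)
    have "(real n powr (1 + \<eta>)) ^ k = real n ^ k * real n powr (\<eta> * real k)"
      using False by (simp add: powr_add power_mult_distrib powr_power mult.commute)
    then have "expectation (?Y n) = moment k n / real n ^ k * (1 / real n powr (\<eta> * real k))"
      by (simp add: power_divide expectation_B_power)
    also have "\<dots> \<le> C * (1 / real n ^ 2)"
      using C False le by (intro mult_mono divide_left_mono) auto
    finally show ?thesis .
  qed
  have "(\<integral>\<^sup>+\<omega>. (\<Sum>n. ennreal (?Y n \<omega>)) \<partial>M) = (\<Sum>n. \<integral>\<^sup>+\<omega>. ennreal (?Y n \<omega>) \<partial>M)"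
    by (rule nn_integral_suminf) measurable
  also have "\<dots> \<le> (\<Sum>n. ennreal (C * (1 / real n ^ 2)))"
  proof (intro suminf_le allI summableI)
    fix n
    have "integrable M (?Y n)"
      by (simp add: power_divide integrable_B_power)
    \<comment> \<open>\<open>ennreal\<close> truncates negative values to 0; nonnegativity is what
      identifies the integral with the expectation.\<close>
    moreover have "AE \<omega> in M. 0 \<le> ?Y n \<omega>"
      using AE_B_nonneg[of n] by eventually_elim simp
    ultimately have "(\<integral>\<^sup>+\<omega>. ennreal (?Y n \<omega>) \<partial>M) = ennreal (expectation (?Y n))"
      by (rule nn_integral_eq_integral)
    then show "(\<integral>\<^sup>+\<omega>. ennreal (?Y n \<omega>) \<partial>M) \<le> ennreal (C * (1 / real n ^ 2))"
      using exp[of n] by (simp add: ennreal_leI)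
  qed
  also have "\<dots> < \<infinity>"
  proof -
    have "summable (\<lambda>n. C * (1 / real n ^ 2))"
      using inverse_power_summable[of 2, where 'a = real]
      by (intro summable_mult) (simp add: inverse_eq_divide)
    then show ?thesis
      using C(1) by (subst suminf_ennreal2) auto
  qed
  finally have "AE \<omega> in M. (\<Sum>n. ennreal (?Y n \<omega>)) \<noteq> \<infinity>"
    by (intro nn_integral_PInf_AE) auto
  moreover have "AE \<omega> in M. \<forall>n. B n \<omega> \<ge> 0"
    using AE_B_nonneg by (simp add: AE_all_countable)
  ultimately show ?thesis
  proof eventually_elim
    case (elim \<omega>)
    have "summable (\<lambda>n. ?Y n \<omega>)"
      using elim by (intro summable_suminf_not_top) auto
    \<comment> \<open>Terms of a convergent series tend to 0. The k-th root is continuous and, as k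
      > 0 and the counts are nonnegative, undoes the k-th power.\<close>
    then have "(\<lambda>n. root k (?Y n \<omega>)) \<longlonglongrightarrow> root k 0"
      by (intro tendsto_real_root summable_LIMSEQ_zero)
    then show ?case
      using elim k0 by (simp add: real_root_power_cancel)
  qed
qed

end

theorem proposition1p1:
  fixes M :: "'w measure"
    and \<nu> :: "nat \<Rightarrow> 'w \<Rightarrow> nat list"
    and \<tau> :: "nat \<Rightarrow> 'w \<Rightarrow> nat list set"
    and B :: "nat \<Rightarrow> 'w \<Rightarrow> real"
  assumes "doubling_tree_process M \<nu> \<tau>"
  defines "B \<equiv> \<lambda>n \<omega>. nonroot_count (\<tau> n \<omega>)"
  shows
    "(\<forall>k\<ge>1.
        (\<lambda>n. prob_space.expectation M (\<lambda>\<omega>. (B n \<omega> / real n) ^ k)) \<longlonglongrightarrow> moment_limit k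
        \<and> moment_limit k
            = 2 ^ (k * (k + 1) div 2) / fact k * (\<Prod>i=1..k. 1 + (real i - 1) / 2 ^ i))
     \<and> tight (\<lambda>n. distr M borel (\<lambda>\<omega>. B (Suc n) \<omega> / real (Suc n)))
     \<and> (\<forall>w :: nat \<Rightarrow> real. (\<lambda>n. real n) \<in> o(w) \<longrightarrow>
          tendsto_in_prob M (\<lambda>n \<omega>. B n \<omega> / w n) 0)
     \<and> (\<forall>\<eta>>0. AE \<omega> in M. (\<lambda>n. B n \<omega> / real n powr (1 + \<eta>)) \<longlonglongrightarrow> 0)"
proof -
  interpret P: doubling_tree_process M \<nu> \<tau> by fact
  have B: "B = P.B" by (simp add: B_def P.B_def fun_eq_iff)
  show ?thesis
    unfolding B using P.moments_converge moment_limit_eq P.tight_B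
      P.B_over_superlinear_in_prob P.B_over_power_AE by blast
qed

end
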